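(* Let $F:[0,1]\to\mathbb{R}$ be a non-linear twice-differentiable function. Then for any set $X$ of lines in $\mathbb{R}^2$ with $\operatorname{graph}(F)\subset\bigcup X$, the union $\bigcup X$ has Hausdorff dimension $2$.
   Context: "Non-linear" means that $F$ is not of the form $F(x)=ax+b$ on $[0,1]$, i.e. its graph is not contained in a line. $\operatorname{graph}(F)=\{(x,F(x)) : x\in[0,1]\}\subset\mathbb{R}^2$. Twice-differentiable means that $F''$ exists (finite) at every point of $[0,1]$, with one-sided derivatives at the endpoints; $F''$ is not assumed continuous. *)

theory Defs
  imports "HOL-Analysis.Analysis"
begin

(* The cost of a covering set U is (diam U)^s, with the usual conventions
   0^0 = 1 for nonempty U and cost 0 for the empty set; these need a case
   distinction because 0 powr 0 = 0 in the library. Only meant for bounded U. *)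
definition hausdorff_cost :: "real \<Rightarrow> 'a::metric_space set \<Rightarrow> ennreal" where
  "hausdorff_cost s U =
     (if U = {} then 0 else if s = 0 then 1 else ennreal (diameter U powr s))"

(* Boundedness of the covering sets is required explicitly because the library's
   diameter of an unbounded set carries no information. *)
definition hausdorff_premeasure :: "real \<Rightarrow> real \<Rightarrow> 'a::metric_space set \<Rightarrow> ennreal" where
  "hausdorff_premeasure \<delta> s A =
     (INF U \<in> {U :: nat \<Rightarrow> 'a set.
                 A \<subseteq> (\<Union>i. U i) \<and> (\<forall>i. bounded (U i) \<and> diameter (U i) \<le> \<delta>)}.
        \<Sum>i. hausdorff_cost s (U i))"

definition hausdorff_measure :: "real \<Rightarrow> 'a::metric_space set \<Rightarrow> ennreal" where
  "hausdorff_measure s A = (SUP \<delta>\<in>{0<..}. hausdorff_premeasure \<delta> s A)"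

definition hausdorff_dim :: "'a::metric_space set \<Rightarrow> ennreal" where
  "hausdorff_dim A = Inf {ennreal s |s. 0 \<le> s \<and> hausdorff_measure s A = 0}"

definition is_line :: "'a::euclidean_space set \<Rightarrow> bool" where
  "is_line L \<longleftrightarrow> affine L \<and> aff_dim L = 1"

(* Derivatives are taken within S, hence one-sided at the endpoints of an interval;
   the library's deriv would need F outside S there. *)
definition twice_differentiable_on :: "(real \<Rightarrow> real) \<Rightarrow> real set \<Rightarrow> bool" where
  "twice_differentiable_on F S \<longleftrightarrow>
     (\<exists>F' F''. \<forall>x\<in>S. (F has_real_derivative F' x) (at x within S) \<and>
                    (F' has_real_derivative F'' x) (at x within S))"

definition graph_on :: "(real \<Rightarrow> real) \<Rightarrow> real set \<Rightarrow> (real \<times> real) set" where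
  "graph_on F S = (\<lambda>x. (x, F x)) ` S"

end

theory Submission
  imports Defs
begin

text \<open>
  Two non-vertical lines \<open>y = a + b t\<close> whose parameters \<open>(a, b)\<close> lie at distance \<open>D\<close> can stay
  \<open>1/n\<close>-close only for a set of \<open>t\<close> of length about \<open>1/(nD)\<close>. Hence a family of lines indexed by a
  set \<open>A\<close> of reals, with parameters expanding distances in \<open>A\<close>, overlaps itself only
  logarithmically, by Cordoba's \<open>L\<^sup>2\<close> argument, and its union is two-dimensional unless \<open>A\<close> is a
  null set (\<open>thin_line_union_imp_negligible\<close>). The lines carry no measurability whatsoever, so this
  is proved by counting dyadic squares. If the union is covered so efficiently that its
  \<open>s\<close>-dimensional Hausdorff measure vanishes for some \<open>s < 2\<close>, then for every line there
  is a scale whose squares cover a noticeable portion of the line. At each scale the lines covered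
  in this way are few, by Cauchy--Schwarz, and the total length of the index intervals they occupy is
  summable over the scales.

  A curve supplies such a family. For \<open>x\<close> in \<open>[0,1]\<close> choose a covering line through \<open>(x, F x)\<close>. At
  the indices where the line is vertical, the lines are separated by their abscissas. Where it
  crosses the graph transversally, comparing two of the lines at the abscissa of one
  of the base points separates them. Where it is tangent, its slope is \<open>F' x\<close>,
  and separation holds as soon as \<open>F'' x \<noteq> 0\<close>. These three cases exhaust \<open>F'' \<noteq> 0\<close>, so
  that a union of dimension below 2 forces \<open>F'' = 0\<close> almost everywhere
  (\<open>curvature_negligible_if_thin_line_cover\<close>).

  Finally \<open>F''\<close> is the derivative of \<open>F'\<close> at every point, so the fundamental theorem of calculus for
  the Henstock--Kurzweil integral applies although \<open>F''\<close> may be discontinuous. Thus \<open>F'\<close> is constant and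
  \<open>F\<close> is affine (\<open>affine_if_second_derivative_ae_zero\<close>). The bound from above,
  that no plane set has dimension more than 2, comes from subdividing unit squares.
\<close>

section \<open>Incidences between separated lines and grid squares\<close>

lemma card_int_set_le_diameter:
  fixes S :: "int set" and L :: real
  assumes "finite S" and "0 \<le> L" and diff: "\<And>p q. p \<in> S \<Longrightarrow> q \<in> S \<Longrightarrow> real_of_int (p - q) \<le> L"
  shows "real (card S) \<le> L + 1"
proof (cases "S = {}")
  case False
  have "S \<subseteq> {Min S..Max S}" using assms(1) by auto
  then have "card S \<le> card {Min S..Max S}" by (intro card_mono) auto
  moreover have "real_of_int (Max S - Min S) \<le> L"
    using diff assms(1) False by simp
  moreover have "Min S \<le> Max S" using assms(1) False by simp
  ultimately show ?thesis by simp
qed (use assms in simp)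

text \<open>
  This is the transversality estimate: the affine function \<open>\<alpha> + \<beta> t\<close> on \<open>[0,1]\<close>, sampled at the points
  \<open>p/n\<close>, is at most \<open>K/n\<close> in modulus for \<open>O(1 + K/D)\<close> of the samples. If \<open>\<beta>\<close> is large the
  solutions lie in a short interval; if not, \<open>\<alpha>\<close> dominates and a solution can exist only when \<open>n\<close>
  itself is at most \<open>2 K / D\<close>.
\<close>

lemma card_small_values_affine_le:
  fixes \<alpha> \<beta> D K :: real and n :: nat
  assumes "0 < D" "D \<le> \<bar>\<alpha>\<bar> + \<bar>\<beta>\<bar>" "0 \<le> K"
  shows "real (card {p \<in> {0..<int n}. \<bar>\<alpha> * n + \<beta> * p\<bar> \<le> K}) \<le> 8 * K / D + 1"
    (is "real (card ?S) \<le> _")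
proof -
  have fin: "finite ?S" by (rule finite_subset[of _ "{0..<int n}"]) auto
  show ?thesis
  proof (cases "D / 4 \<le> \<bar>\<beta>\<bar>")
    case True
    show ?thesis
    proof (rule card_int_set_le_diameter[OF fin])
      fix p q assume p: "p \<in> ?S" and q: "q \<in> ?S"
      have "\<bar>\<beta> * (p - q)\<bar> \<le> 2 * K"
      proof -
        have "\<beta> * (p - q) = (\<alpha> * n + \<beta> * p) - (\<alpha> * n + \<beta> * q)" by (simp add: algebra_simps)
        then show ?thesis using p q by auto
      qed
      then have "\<bar>\<beta>\<bar> * \<bar>real_of_int (p - q)\<bar> \<le> 2 * K" by (simp add: abs_mult)
      moreover have "D / 4 * \<bar>real_of_int (p - q)\<bar> \<le> \<bar>\<beta>\<bar> * \<bar>real_of_int (p - q)\<bar>"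
        using True by (intro mult_right_mono) auto
      ultimately have "D * \<bar>real_of_int (p - q)\<bar> \<le> 8 * K" by linarith
      then have "\<bar>real_of_int (p - q)\<bar> \<le> 8 * K / D" 
        using assms(1) by (simp add: pos_le_divide_eq mult.commute)
      then show "real_of_int (p - q) \<le> 8 * K / D" by linarith
    qed (use assms in simp)
  next
    case False
    then have \<alpha>: "3 * D / 4 \<le> \<bar>\<alpha>\<bar>" using assms by linarith
    have "real (card ?S) \<le> 8 * K / D"
    proof (cases "?S = {}")
      case True
      then have "card ?S = 0" by (metis card.empty)
      then show ?thesis using assms by simp
    next
      case ne: False
      then obtain p where p: "0 \<le> p" "p < int n" "\<bar>\<alpha> * n + \<beta> * p\<bar> \<le> K" by auto
      have "\<bar>\<beta> * p\<bar> \<le> D / 4 * n" 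
        unfolding abs_mult using False p assms(1) by (intro mult_mono) auto
      moreover have "3 * D / 4 * n \<le> \<bar>\<alpha> * n\<bar>"
        using mult_right_mono[OF \<alpha>, of "real n"] by (simp add: abs_mult)
      ultimately have "D / 2 * n \<le> K" using p(3) by (auto simp: algebra_simps)
      then have "n \<le> 2 * K / D" using assms(1) by (simp add: field_simps)
      also have "\<dots> \<le> 8 * K / D" using assms by (simp add: divide_right_mono)
      moreover have "card ?S \<le> card {0..<int n}" by (intro card_mono) auto
      ultimately show ?thesis by simp
    qed
    then show ?thesis by simp
  qed
qed

text \<open>
  Counting incidences through \<open>G\<close> expresses the left-hand sum as a sum over \<open>G\<close> of multiplicities, whose
  square sum counts coinciding pairs. A family with small pairwise
  intersections therefore needs a large ground set.
\<close>

lemma incidence_Cauchy_Schwarz: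
  fixes Y :: "'j \<Rightarrow> 'g set"
  assumes "finite J" "finite G" "\<And>j. j \<in> J \<Longrightarrow> Y j \<subseteq> G"
  shows "(\<Sum>j\<in>J. real (card (Y j)))\<^sup>2 \<le> card G * (\<Sum>i\<in>J. \<Sum>j\<in>J. real (card (Y i \<inter> Y j)))"
proof -
  define ind where "ind = (\<lambda>j g. if g \<in> Y j then 1 else 0 :: real)"
  have c1: "real (card (Y j)) = (\<Sum>g\<in>G. ind j g)" if "j \<in> J" for j
    using assms(2) assms(3)[OF that] unfolding ind_def by (simp add: sum.If_cases Int_absorb1)
  have c2: "real (card (Y i \<inter> Y j)) = (\<Sum>g\<in>G. ind i g * ind j g)" if "i \<in> J" "j \<in> J" for i j
  proof -
    have "(\<Sum>g\<in>G. ind i g * ind j g) = (\<Sum>g\<in>G. if g \<in> Y i \<inter> Y j then 1 else 0)"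
      unfolding ind_def by (intro sum.cong) auto
    also have "\<dots> = card (G \<inter> (Y i \<inter> Y j))" using assms(2) by (simp add: sum.If_cases Int_def)
    also have "G \<inter> (Y i \<inter> Y j) = Y i \<inter> Y j" using assms(3) that by auto
    finally show ?thesis by simp
  qed
  have "(\<Sum>j\<in>J. real (card (Y j))) = (\<Sum>g\<in>G. 1 * (\<Sum>j\<in>J. ind j g))"
    using c1 sum.swap[of ind G J] by simp
  then have "(\<Sum>j\<in>J. real (card (Y j)))\<^sup>2 \<le> (\<Sum>g\<in>G. 1\<^sup>2) * (\<Sum>g\<in>G. (\<Sum>j\<in>J. ind j g)\<^sup>2)"
    using Cauchy_Schwarz_ineq_sum[of "\<lambda>_. 1" "\<lambda>g. \<Sum>j\<in>J. ind j g" G] by simp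
  also have "(\<Sum>g\<in>G. (\<Sum>j\<in>J. ind j g)\<^sup>2) = (\<Sum>i\<in>J. \<Sum>j\<in>J. \<Sum>g\<in>G. ind i g * ind j g)"
    unfolding power2_eq_square sum_product
    by (subst sum.swap, intro sum.cong refl) (rule sum.swap)
  also have "\<dots> = (\<Sum>i\<in>J. \<Sum>j\<in>J. real (card (Y i \<inter> Y j)))"
    using c2 by simp
  finally show ?thesis by simp
qed

lemma sum_inverse_distance_le:
  fixes i :: int and n :: nat
  assumes "i \<in> {0..<int n}" "J \<subseteq> {0..<int n}"
  shows "(\<Sum>j\<in>J. 1 / (1 + \<bar>real_of_int (i - j)\<bar>)) \<le> 2 * harm n"
proof -
  have half: "(\<Sum>j\<in>S. 1 / (1 + \<bar>real_of_int (i - j)\<bar>)) \<le> harm n"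
    if "inj_on (\<lambda>j. nat (1 + \<bar>i - j\<bar>)) S" "S \<subseteq> {0..<int n}" for S
  proof -
    have "(\<Sum>j\<in>S. 1 / (1 + \<bar>real_of_int (i - j)\<bar>))
        = (\<Sum>m\<in>(\<lambda>j. nat (1 + \<bar>i - j\<bar>)) ` S. inverse (real m))"
      using that(1) by (subst sum.reindex) (auto simp: inverse_eq_divide intro!: sum.cong)
    also have "\<dots> \<le> (\<Sum>m\<in>{1..n}. inverse (real m))"
      using that(2) assms(1) by (intro sum_mono2) (force simp: subset_iff)+
    finally show ?thesis by (simp add: harm_def)
  qed
  have fin: "finite J" using assms(2) finite_subset by blast
  have "J = (J \<inter> {..i}) \<union> (J \<inter> {i<..})" by auto
  then have "(\<Sum>j\<in>J. 1 / (1 + \<bar>real_of_int (i - j)\<bar>))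
    = (\<Sum>j\<in>J \<inter> {..i}. 1 / (1 + \<bar>real_of_int (i - j)\<bar>)) + (\<Sum>j\<in>J \<inter> {i<..}. 1 / (1 + \<bar>real_of_int (i - j)\<bar>))"
    using fin by (subst sum.union_disjoint[symmetric]) auto
  also have "\<dots> \<le> harm n + harm n"
    using assms(2) by (intro add_mono half) (auto intro!: inj_onI)
  finally show ?thesis by simp
qed

text \<open>
  The pairs in \<open>G\<close> are the corners, in units of \<open>1/n\<close>, of grid squares of side \<open>1/n\<close>. The line
  \<open>y = a + b t\<close> may meet several of them in one vertical strip. Counting strips
  instead of squares makes the count comparable to the length of the set of parameters \<open>t\<close> that it covers.
\<close>

definition columns_met :: "nat \<Rightarrow> real \<Rightarrow> real \<Rightarrow> (int \<times> int) set \<Rightarrow> int set" where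
  "columns_met n a b G =
     {p \<in> {0..<int n}. \<exists>t. \<lfloor>real n * t\<rfloor> = p \<and> (p, \<lfloor>real n * (a + b * t)\<rfloor>) \<in> G}"

text \<open>
  This is the single-scale form of Cordoba's argument. Choosing one square of \<open>G\<close> in each strip met
  by a line, two lines with indices \<open>i\<close> and \<open>j\<close> share \<open>O(n / (1 + \<bar>i - j\<bar>))\<close> of the chosen squares,
  and summing these overlaps costs only a harmonic factor. The separation hypothesis is weakened by
  one unit because an index records a real parameter only up to the side \<open>1/n\<close> of its cell.
\<close>

lemma separated_lines_meet_many_cells:
  fixes n :: nat and a b :: "int \<Rightarrow> real" and G :: "(int \<times> int) set" and c M h :: real
  assumes "0 < n" "J \<subseteq> {0..<int n}" "finite G" "0 < c" "0 \<le> M" "0 \<le> h"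
    and slope: "\<And>j. j \<in> J \<Longrightarrow> \<bar>b j\<bar> \<le> M"
    and sep: "\<And>i j. i \<in> J \<Longrightarrow> j \<in> J \<Longrightarrow>
                c * (\<bar>real_of_int (i - j)\<bar> - 1) / n \<le> \<bar>a i - a j\<bar> + \<bar>b i - b j\<bar>"
    and rich: "\<And>j. j \<in> J \<Longrightarrow> h \<le> card (columns_met n (a j) (b j) G)"
  shows "card J * h\<^sup>2 \<le> 4 * (16 * (1 + 2 * M) / c + 1) * card G * n * harm n"
proof -
  define K where "K = 1 + 2 * M"
  define C where "C = 2 * (16 * K / c + 1)"
  have K: "1 \<le> K" using assms by (simp add: K_def)
  have C: "2 \<le> C" using K assms by (simp add: C_def)
  have finJ: "finite J" using assms(2) finite_subset by blast
  have "\<forall>j. \<exists>g. \<forall>p\<in>columns_met n (a j) (b j) G.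
          (p, g p) \<in> G \<and> (\<exists>t. \<lfloor>real n * t\<rfloor> = p \<and> g p = \<lfloor>real n * (a j + b j * t)\<rfloor>)"
    unfolding columns_met_def by (intro allI bchoice) auto
  then obtain g where g: "\<And>j p. p \<in> columns_met n (a j) (b j) G \<Longrightarrow> (p, g j p) \<in> G"
    and gt: "\<And>j p. p \<in> columns_met n (a j) (b j) G \<Longrightarrow>
               \<exists>t. \<lfloor>real n * t\<rfloor> = p \<and> g j p = \<lfloor>real n * (a j + b j * t)\<rfloor>"
    by metis
  define Y where "Y = (\<lambda>j. (\<lambda>p. (p, g j p)) ` columns_met n (a j) (b j) G)"
  have YG: "Y j \<subseteq> G" for j using g by (auto simp: Y_def)
  have cardY: "card (Y j) = card (columns_met n (a j) (b j) G)" for j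
    unfolding Y_def by (intro card_image inj_onI) auto
  have finc: "finite (columns_met n (a j) (b j) G)" for j
    by (rule finite_subset[of _ "{0..<int n}"]) (auto simp: columns_met_def)
  have cardn: "card (columns_met n (a j) (b j) G) \<le> n" for j
    using card_mono[of "{0..<int n}" "columns_met n (a j) (b j) G"]
    by (simp add: columns_met_def subset_iff)
  \<comment> \<open>Moving to the left end of the strip changes each line by at most \<open>M/n\<close>, and two points of one
    square differ in height by less than \<open>1/n\<close>; this gives \<open>K = 1 + 2 M\<close>.\<close>
  have near: "\<bar>(a i - a j) * n + (b i - b j) * p\<bar> \<le> K"
    if ij: "i \<in> J" "j \<in> J" and p: "p \<in> columns_met n (a i) (b i) G" "p \<in> columns_met n (a j) (b j) G"
      and e: "g i p = g j p" for i j p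
  proof -
    obtain t where t: "\<lfloor>real n * t\<rfloor> = p" "g i p = \<lfloor>real n * (a i + b i * t)\<rfloor>"
      using gt[OF p(1)] by auto
    obtain u where u: "\<lfloor>real n * u\<rfloor> = p" "g j p = \<lfloor>real n * (a j + b j * u)\<rfloor>"
      using gt[OF p(2)] by auto
    have "\<bar>real n * (a i + b i * t) - real n * (a j + b j * u)\<bar> < 1"
      using t(2) u(2) e by linarith
    moreover have "\<bar>b i * (real n * t - p)\<bar> \<le> M * 1"
      unfolding abs_mult using slope[OF ij(1)] t(1) assms(5) by (intro mult_mono) (auto, linarith)
    moreover have "\<bar>b j * (real n * u - p)\<bar> \<le> M * 1"
      unfolding abs_mult using slope[OF ij(2)] u(1) assms(5) by (intro mult_mono) (auto, linarith)
    ultimately show ?thesis unfolding K_def by (simp add: algebra_simps)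
  qed
  have common: "real (card (Y i \<inter> Y j)) \<le> C * n * (1 / (1 + \<bar>real_of_int (i - j)\<bar>))"
    if ij: "i \<in> J" "j \<in> J" for i j
  proof (cases "\<bar>i - j\<bar> \<le> 1")
    case True
    have "card (Y i \<inter> Y j) \<le> card (Y i)"
      using finc by (intro card_mono) (auto simp: Y_def)
    also have "\<dots> \<le> n" using cardY cardn by simp
    finally have "real (card (Y i \<inter> Y j)) * (1 + \<bar>real_of_int (i - j)\<bar>) \<le> real n * 2"
      using True by (intro mult_mono) auto
    also have "\<dots> \<le> C * n" using mult_right_mono[OF C, of "real n"] by simp
    finally show ?thesis by (simp add: pos_le_divide_eq)
  next
    case False
    define r where "r = \<bar>real_of_int (i - j)\<bar>"
    have r: "2 \<le> r" "r \<le> n" proof -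
      have "2 \<le> \<bar>i - j\<bar>" "\<bar>i - j\<bar> \<le> int n"
        using False subsetD[OF assms(2) ij(1)] subsetD[OF assms(2) ij(2)] by auto
      then show "2 \<le> r" "r \<le> n" unfolding r_def by linarith+
    qed
    \<comment> \<open>Halving the separation absorbs the loss of one unit, since here \<open>r \<ge> 2\<close>.\<close>
    define D where "D = c * r / (2 * n)"
    have D0: "0 < D" using r assms by (auto simp: D_def)
    have "c * r / 2 \<le> c * (r - 1)" using r assms(4) by (simp add: field_simps)
    then have "D \<le> c * (r - 1) / n"
      using assms(1) by (simp add: D_def field_simps)
    then have D1: "D \<le> \<bar>a i - a j\<bar> + \<bar>b i - b j\<bar>" using sep[OF ij] unfolding r_def by (rule order_trans)
    let ?S = "{p \<in> {0..<int n}. \<bar>(a i - a j) * n + (b i - b j) * p\<bar> \<le> K}"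
    have "Y i \<inter> Y j \<subseteq> (\<lambda>p. (p, g i p)) ` ?S"
      using near[OF ij] by (auto simp: Y_def columns_met_def image_iff)
    then have "card (Y i \<inter> Y j) \<le> card ?S"
      by (intro surj_card_le) (auto intro: finite_subset[of _ "{0..<int n}"])
    also have "real (card ?S) \<le> 8 * K / D + 1"
      using D0 D1 K by (intro card_small_values_affine_le) auto
    also have "8 * K / D + 1 = 16 * K / c * (n / r) + 1"
      using assms r by (simp add: D_def field_simps)
    also have "\<dots> \<le> 16 * K / c * (n / r) + n / r" using r by (simp add: field_simps)
    also have "\<dots> = (C * n) * (1 / (2 * r))"
      using r assms(4) by (simp add: C_def add_divide_distrib distrib_left distrib_right)
    also have "\<dots> \<le> (C * n) * (1 / (1 + r))"
      using r C by (intro mult_left_mono) (auto simp: field_simps)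
    finally show ?thesis by (simp add: r_def)
  qed
  show ?thesis
  proof (cases "J = {}")
    case True
    then show ?thesis using assms C K by (simp add: C_def K_def harm_nonneg)
  next
    case False
    have "(card J * h)\<^sup>2 \<le> (\<Sum>j\<in>J. real (card (Y j)))\<^sup>2"
      using sum_bounded_below[of J h "\<lambda>j. real (card (Y j))"] rich cardY assms(6)
      by (intro power_mono) auto
    also have "\<dots> \<le> card G * (\<Sum>i\<in>J. \<Sum>j\<in>J. real (card (Y i \<inter> Y j)))"
      using YG finJ assms(3) by (intro incidence_Cauchy_Schwarz) auto
    also have "\<dots> \<le> card G * (\<Sum>i\<in>J. \<Sum>j\<in>J. C * n * (1 / (1 + \<bar>real_of_int (i - j)\<bar>)))"
      by (intro mult_left_mono sum_mono common) auto
    also have "\<dots> \<le> card G * (\<Sum>i\<in>J. C * n * (2 * harm n))"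
    proof (intro mult_left_mono[OF sum_mono])
      fix i assume "i \<in> J"
      then have "(\<Sum>j\<in>J. 1 / (1 + \<bar>real_of_int (i - j)\<bar>)) \<le> 2 * harm n"
        using assms(2) by (intro sum_inverse_distance_le) auto
      then show "(\<Sum>j\<in>J. C * n * (1 / (1 + \<bar>real_of_int (i - j)\<bar>))) \<le> C * n * (2 * harm n)"
        unfolding sum_distrib_left[symmetric] using C by (intro mult_left_mono) auto
    qed simp
    also have "\<dots> = card J * (2 * C * card G * n * harm n)" by simp
    finally have "card J * (card J * h\<^sup>2) \<le> card J * (2 * C * card G * n * harm n)"
      by (simp add: power2_eq_square mult_ac)
    moreover have "0 < real (card J)" using False finJ by (simp add: card_gt_0_iff)
    ultimately have "card J * h\<^sup>2 \<le> 2 * C * card G * n * harm n"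
      by (simp only: mult_le_cancel_left_pos)
    then show ?thesis by (simp add: C_def K_def)
  qed
qed

section \<open>Thin unions of lines have null index sets\<close>

lemma dyadic_cells_outer_measure:
  fixes S :: "real set" and J :: "nat \<Rightarrow> int set" and l :: "nat \<Rightarrow> nat"
  assumes S: "S \<subseteq> (\<Union>m. {x. \<lfloor>2 ^ l m * x\<rfloor> \<in> J m})"
    and fin: "\<And>m. finite (J m)"
    and w: "\<And>m. card (J m) / 2 ^ l m \<le> w m" and "summable w"
  shows "\<exists>T. S \<subseteq> T \<and> T \<in> lmeasurable \<and> measure lebesgue T \<le> suminf w"
proof -
  have w0: "0 \<le> w m" for m by (rule order_trans[OF _ w]) simp
  define c where "c = (\<lambda>m (q::int). {q / 2 ^ l m..<(q + 1) / 2 ^ l m :: real})"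
  have cell: "\<lfloor>2 ^ l m * x\<rfloor> = q \<longleftrightarrow> x \<in> c m q" for m x q
    by (simp add: c_def floor_eq_iff pos_divide_le_eq pos_less_divide_eq mult.commute)
  define T where "T = (\<Union>m. \<Union>q\<in>J m. c m q)"
  have ST: "S \<subseteq> T" using S by (auto simp: T_def subset_iff simp flip: cell)
  have [measurable]: "c m q \<in> sets lebesgue" for m q by (simp add: c_def)
  have Tm: "(\<Union>q\<in>J m. c m q) \<in> sets lebesgue" for m
    using fin by (intro sets.finite_UN) auto
  then have Ts: "T \<in> sets lebesgue" unfolding T_def by blast
  have "emeasure lebesgue (\<Union>q\<in>J m. c m q) \<le> ennreal (w m)" for m
  proof -
    have "emeasure lebesgue (\<Union>q\<in>J m. c m q) \<le> (\<Sum>q\<in>J m. emeasure lebesgue (c m q))"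
      using fin by (intro emeasure_subadditive_finite) auto
    also have "\<dots> = (\<Sum>q\<in>J m. ennreal (1 / 2 ^ l m))"
      by (intro sum.cong refl) (simp add: c_def divide_right_mono flip: diff_divide_distrib)
    also have "\<dots> = ennreal (card (J m) / 2 ^ l m)"
      by (subst sum_ennreal) auto
    also have "\<dots> \<le> ennreal (w m)" using w by (intro ennreal_leI)
    finally show ?thesis .
  qed
  then have "emeasure lebesgue T \<le> (\<Sum>m. ennreal (w m))"
    unfolding T_def using Tm
    by (intro order_trans[OF emeasure_subadditive_countably] suminf_le) auto
  also have "\<dots> = ennreal (suminf w)" using w0 \<open>summable w\<close> by (rule suminf_ennreal2)
  finally have T: "emeasure lebesgue T \<le> ennreal (suminf w)" .
  have "T \<in> lmeasurable"
    using Ts order_le_less_trans[OF T ennreal_less_top] by (intro fmeasurableI) auto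
  moreover have "measure lebesgue T \<le> suminf w"
    unfolding measure_def using T suminf_nonneg[OF \<open>summable w\<close> w0] by (intro enn2real_leI) auto
  ultimately show ?thesis using ST by blast
qed

text \<open>
  Each dyadic block of the harmonic sum is at most 1, so the loss incurred in the overlap count is
  linear in the scale exponent, hence harmless against any geometric gain.
\<close>

lemma harm_power2_le: "harm (2 ^ k) \<le> real k + 1"
proof (induction k)
  case (Suc k)
  have "(\<Sum>m\<in>{2^k<..2^(Suc k)}. inverse (real m)) \<le> (\<Sum>m\<in>{2^k<..2^(Suc k)::nat}. inverse (2 ^ k))"
    by (intro sum_mono le_imp_inverse_le) (auto simp flip: of_nat_power)
  also have "\<dots> = 1" by simp
  finally have "(\<Sum>m\<in>{2^k<..2^(Suc k)}. inverse (real m)) \<le> 1" .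
  moreover have "{1..2 ^ Suc k::nat} = {1..2 ^ k} \<union> {2^k<..2^(Suc k)}" by auto
  then have "harm (2 ^ Suc k) = harm (2 ^ k) + (\<Sum>m\<in>{2^k<..2^(Suc k)}. inverse (real m))"
    unfolding harm_def by (simp only:) (subst sum.union_disjoint, auto)
  ultimately show ?case using Suc by simp
qed (simp add: harm_def)

text \<open>
  This is what an \<open>s\<close>-dimensional null cover leaves behind once its sets are replaced by dyadic squares
  and sorted by the side length \<open>2 powr (- k)\<close>. Only squares of side at most \<open>2 powr (- k0)\<close> are used, with \<open>k0\<close>
  arbitrary, while the bound on their number stays uniform in \<open>k0\<close>.
\<close>

definition dyadically_thin :: "real \<Rightarrow> (real \<times> real) set \<Rightarrow> bool" where
  "dyadically_thin s E \<longleftrightarrow>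
     (\<exists>C. \<forall>k0. \<exists>G :: nat \<Rightarrow> (int \<times> int) set. (\<forall>k. finite (G k) \<and> real (card (G k)) \<le> C * 2 powr (s * k)) \<and>
        (\<forall>(p, q)\<in>E. \<exists>k\<ge>k0. (\<lfloor>2 ^ k * p\<rfloor>, \<lfloor>2 ^ k * q\<rfloor>) \<in> G k))"

text \<open>
  Two pigeonholes over the scales, both with weights \<open>r ^ k\<close>. For each fixed line the scales must
  jointly cover all \<open>t\<close>, so some scale \<open>k\<close> covers a portion of length \<open>r ^ k\<close>. The indices \<open>x\<close>
  for which this happens at scale \<open>k\<close> meet few dyadic intervals, by the single-scale estimate, and
  the lengths of these intervals sum to something that is small for large \<open>k0\<close>. Each dyadic interval
  met by such indices is represented by one of them, which avoids any choice of separated subsets.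
\<close>

lemma thin_line_union_imp_negligible:
  fixes a b :: "real \<Rightarrow> real"
  assumes A: "A \<subseteq> {0..<1}" and s: "s < 2" and c: "0 < c"
    and slope: "\<And>x. x \<in> A \<Longrightarrow> \<bar>b x\<bar> \<le> M"
    and sep: "\<And>x y. x \<in> A \<Longrightarrow> y \<in> A \<Longrightarrow> c * \<bar>x - y\<bar> \<le> \<bar>a x - a y\<bar> + \<bar>b x - b y\<bar>"
    and thin: "dyadically_thin s E"
    and lines: "\<And>x t. x \<in> A \<Longrightarrow> (t, a x + b x * t) \<in> E"
  shows "negligible A"
proof (cases "A = {}")
  case False
  then have M: "0 \<le> M" using slope by (meson abs_ge_zero all_not_in_conv order_trans)
  obtain C where C: "\<And>k0. \<exists>G :: nat \<Rightarrow> (int \<times> int) set. (\<forall>k. finite (G k) \<and> real (card (G k)) \<le> C * 2 powr (s * k)) \<and>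
        (\<forall>(p, q)\<in>E. \<exists>k\<ge>k0. (\<lfloor>2 ^ k * p\<rfloor>, \<lfloor>2 ^ k * q\<rfloor>) \<in> G k)"
    using thin unfolding dyadically_thin_def by blast
  \<comment> \<open>The gain at scale \<open>k\<close> is \<open>2 powr (- (2 - s) k) = r ^ (4 k)\<close>. The lower bound \<open>r ^ k\<close> on the covered
    length enters squared, which leaves \<open>r ^ (2 k)\<close> to beat the harmonic factor.\<close>
  define r where "r = 2 powr (- (2 - s) / 4)"
  have "2 powr (- (2 - s) / 4) < 2 powr 0" using s by (intro powr_less_mono) auto
  then have r: "0 < r" "r < 1" by (auto simp: r_def)
  have r2: "r\<^sup>2 < 1" using r by (simp add: power_less_one_iff)
  have rk: "2 powr (s * k) / (2 ^ k) ^ 2 = ((r ^ k) ^ 2) ^ 2" for k :: nat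
  proof -
    have "((r ^ k) ^ 2) ^ 2 = r powr (4 * k)"
      using r powr_realpow[of r "4 * k"] by (simp flip: power_mult)
    also have "\<dots> = 2 powr (s * k - 2 * k)" 
      unfolding r_def powr_powr by (rule arg_cong[of _ _ "(powr) 2"]) (simp add: field_simps)
    also have "\<dots> = 2 powr (s * k) / (2 ^ k) ^ 2"
      using powr_realpow[of 2 "2 * k"] by (simp add: powr_diff mult.commute flip: power_mult)
    finally show ?thesis ..
  qed
  define C1 where "C1 = 4 * (16 * (1 + 2 * M) / c + 1)"
  have C1: "0 \<le> C1" using M c by (simp add: C1_def)
  define w where "w = (\<lambda>k::nat. C1 * C * (real (Suc k) * (r\<^sup>2) ^ k))"
  have sum_r: "summable (\<lambda>k. r ^ k)" using r by (intro summable_geometric) auto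
  have sum_w: "summable w"
    unfolding w_def using r r2 by (intro summable_mult sums_summable[OF geometric_deriv_sums]) auto
  show ?thesis unfolding negligible_outer_le
  proof (intro allI impI)
    fix e :: real assume "0 < e"
    obtain k1 where k1: "\<And>n. n \<ge> k1 \<Longrightarrow> norm (\<Sum>i. r ^ (i + n)) < 1"
      using suminf_exist_split[OF _ sum_r, of 1] by auto
    obtain k2 where k2: "\<And>n. n \<ge> k2 \<Longrightarrow> norm (\<Sum>i. w (i + n)) < e"
      using suminf_exist_split[OF \<open>0 < e\<close> sum_w] by auto
    define k0 where "k0 = max k1 k2"
    obtain G :: "nat \<Rightarrow> (int \<times> int) set" where G: "\<forall>k. finite (G k) \<and> real (card (G k)) \<le> C * 2 powr (s * k)"
      "\<forall>(p, q)\<in>E. \<exists>k\<ge>k0. (\<lfloor>2 ^ k * p\<rfloor>, \<lfloor>2 ^ k * q\<rfloor>) \<in> G k"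
      using C[of k0] by (elim exE conjE)
    then have finG: "\<And>k::nat. finite (G k)"
      and cardG: "\<And>k::nat. real (card (G k)) \<le> C * 2 powr (s * k)"
      and EG: "\<And>p q. (p, q) \<in> E \<Longrightarrow> \<exists>k\<ge>k0. (\<lfloor>2 ^ k * p\<rfloor>, \<lfloor>2 ^ k * q\<rfloor>) \<in> G k"
      by auto
    have "0 \<le> C * 2 powr (s * 0)" using cardG[of 0] order_trans[OF of_nat_0_le_iff] by fastforce
    then have C0: "0 \<le> C" by simp
    define col where "col = (\<lambda>x m. columns_met (2 ^ (m + k0)) (a x) (b x) (G (m + k0)))"
    define h :: "nat \<Rightarrow> real" where "h = (\<lambda>m. 2 ^ (m + k0) * r ^ (m + k0))"
    have fincol: "finite (col x m)" for x m
      by (rule finite_subset[of _ "{0..<int (2 ^ (m + k0))}"]) (auto simp: col_def columns_met_def)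
    have rich: "\<exists>m. h m \<le> card (col x m)" if x: "x \<in> A" for x
    proof (rule ccontr)
      assume "\<nexists>m. h m \<le> card (col x m)"
      then have poor: "card (col x m) / 2 ^ (m + k0) \<le> r ^ (m + k0)" for m
        by (simp add: h_def pos_divide_le_eq not_le less_imp_le mult.commute)
      have "{0..<1::real} \<subseteq> (\<Union>m. {t. \<lfloor>2 ^ (m + k0) * t\<rfloor> \<in> col x m})"
      proof
        fix t :: real assume t: "t \<in> {0..<1}"
        obtain k where k: "k \<ge> k0" "(\<lfloor>2 ^ k * t\<rfloor>, \<lfloor>2 ^ k * (a x + b x * t)\<rfloor>) \<in> G k"
          using EG[OF lines[OF x]] by blast
        have "0 \<le> \<lfloor>2 ^ k * t\<rfloor>" "\<lfloor>2 ^ k * t\<rfloor> < 2 ^ k"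
          using t by (auto simp: floor_less_iff)
        then have "\<lfloor>2 ^ k * t\<rfloor> \<in> col x (k - k0)"
          using k by (auto simp: col_def columns_met_def)
        then show "t \<in> (\<Union>m. {t. \<lfloor>2 ^ (m + k0) * t\<rfloor> \<in> col x m})"
          using k(1) by (intro UN_I[of "k - k0"]) auto
      qed
      from dyadic_cells_outer_measure[OF this fincol poor]
      obtain T where T: "{0..<1::real} \<subseteq> T" "T \<in> lmeasurable" "measure lebesgue T \<le> (\<Sum>m. r ^ (m + k0))"
        using summable_ignore_initial_segment[OF sum_r] by blast
      have "1 = measure lebesgue {0..<1::real}" by simp
      also have "\<dots> \<le> measure lebesgue T" using T by (intro measure_mono_fmeasurable) auto
      also have "\<dots> < 1" using T(3) k1[of k0] by (simp add: k0_def)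
      finally show False by simp
    qed
    define J where "J = (\<lambda>m. {\<lfloor>2 ^ (m + k0) * x\<rfloor> |x. x \<in> A \<and> h m \<le> card (col x m)})"
    have Jsub: "J m \<subseteq> {0..<int (2 ^ (m + k0))}" for m
    proof -
      have "0 \<le> \<lfloor>2 ^ (m + k0) * x\<rfloor>" "\<lfloor>2 ^ (m + k0) * x\<rfloor> < 2 ^ (m + k0)" if "x \<in> A" for x
        using A that by (auto simp: floor_less_iff)
      then show ?thesis by (auto simp: J_def)
    qed
    have cardJ: "card (J m) / 2 ^ (m + k0) \<le> w (m + k0)" for m
    proof -
      define k where "k = m + k0"
      have "\<forall>j\<in>J m. \<exists>x. x \<in> A \<and> h m \<le> card (col x m) \<and> j = \<lfloor>2 ^ k * x\<rfloor>"
        by (auto simp: J_def k_def)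
      then obtain \<xi> where \<xi>: "\<And>j. j \<in> J m \<Longrightarrow> \<xi> j \<in> A"
        "\<And>j. j \<in> J m \<Longrightarrow> h m \<le> card (col (\<xi> j) m)" "\<And>j. j \<in> J m \<Longrightarrow> j = \<lfloor>2 ^ k * \<xi> j\<rfloor>"
        by metis
      have "card (J m) * (h m)\<^sup>2 \<le> C1 * card (G k) * real (2 ^ k) * harm (2 ^ k)"
        unfolding C1_def
      proof (rule separated_lines_meet_many_cells[where a = "a \<circ> \<xi>" and b = "b \<circ> \<xi>"])
        fix i j assume ij: "i \<in> J m" "j \<in> J m"
        have "\<bar>real_of_int (i - j)\<bar> - 1 \<le> \<bar>2 ^ k * \<xi> i - 2 ^ k * \<xi> j\<bar>"
          using \<xi>(3)[OF ij(1)] \<xi>(3)[OF ij(2)] by linarith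
        also have "\<dots> = 2 ^ k * \<bar>\<xi> i - \<xi> j\<bar>" by (simp add: abs_mult flip: right_diff_distrib)
        finally have "c * (\<bar>real_of_int (i - j)\<bar> - 1) / real (2 ^ k) \<le> c * \<bar>\<xi> i - \<xi> j\<bar>"
          using c by (simp add: pos_divide_le_eq mult_left_mono mult_ac)
        also have "\<dots> \<le> \<bar>a (\<xi> i) - a (\<xi> j)\<bar> + \<bar>b (\<xi> i) - b (\<xi> j)\<bar>"
          by (intro sep \<xi> ij)
        finally show "c * (\<bar>real_of_int (i - j)\<bar> - 1) / real (2 ^ k)
            \<le> \<bar>(a \<circ> \<xi>) i - (a \<circ> \<xi>) j\<bar> + \<bar>(b \<circ> \<xi>) i - (b \<circ> \<xi>) j\<bar>" by simp
      qed (use Jsub finG c M r slope \<xi> in \<open>auto simp: h_def k_def col_def\<close>)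
      also have "\<dots> \<le> C1 * (C * 2 powr (s * k)) * real (2 ^ k) * (real k + 1)"
        using C1 cardG[of k] harm_power2_le[of k] C0
        by (intro mult_mono mult_nonneg_nonneg harm_nonneg) auto
      finally have bound: "card (J m) * (h m)\<^sup>2 \<le> C1 * (C * 2 powr (s * k)) * 2 ^ k * (real k + 1)" by simp
      have hh: "(h m)\<^sup>2 = (2 ^ k)\<^sup>2 * (r ^ k)\<^sup>2" by (simp add: h_def k_def power_mult_distrib)
      have pw: "2 powr (s * k) = (2 ^ k)\<^sup>2 * ((r ^ k)\<^sup>2)\<^sup>2"
        using rk[of k] by (simp add: field_simps)
      have "((2 ^ k)\<^sup>2 * (r ^ k)\<^sup>2) * card (J m)
          \<le> ((2 ^ k)\<^sup>2 * (r ^ k)\<^sup>2) * (C1 * C * (real k + 1) * (r ^ k)\<^sup>2 * 2 ^ k)"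
        using bound unfolding hh pw by (simp add: power2_eq_square mult_ac)
      then have "card (J m) \<le> C1 * C * (real k + 1) * (r ^ k)\<^sup>2 * 2 ^ k"
        using r by (subst (asm) mult_le_cancel_left_pos) auto
      moreover have "(r ^ k)\<^sup>2 = (r\<^sup>2) ^ k" by (simp add: mult.commute flip: power_mult)
      ultimately have "card (J m) \<le> w k * 2 ^ k" by (simp add: w_def mult_ac add_ac)
      then show ?thesis by (simp add: k_def field_simps)
    qed
    have "A \<subseteq> (\<Union>m. {x. \<lfloor>2 ^ (m + k0) * x\<rfloor> \<in> J m})"
    proof
      fix x assume "x \<in> A"
      with rich obtain m where "h m \<le> card (col x m)" by blast
      with \<open>x \<in> A\<close> show "x \<in> (\<Union>m. {x. \<lfloor>2 ^ (m + k0) * x\<rfloor> \<in> J m})"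
        by (intro UN_I[of m]) (auto simp: J_def)
    qed
    from dyadic_cells_outer_measure[OF this _ cardJ]
    obtain T where T: "A \<subseteq> T" "T \<in> lmeasurable" "measure lebesgue T \<le> (\<Sum>m. w (m + k0))"
      using finite_subset[OF Jsub] summable_ignore_initial_segment[OF sum_w] by blast
    moreover have "(\<Sum>m. w (m + k0)) < e" using k2[of k0] by (simp add: k0_def)
    ultimately show "\<exists>T. A \<subseteq> T \<and> T \<in> lmeasurable \<and> measure lebesgue T \<le> e"
      by (intro exI[of _ T]) auto
  qed
qed simp

section \<open>Hausdorff null sets in the plane\<close>

lemma hausdorff_null_cover:
  assumes "hausdorff_measure s A = 0" "0 < \<delta>" "0 < \<epsilon>"
  obtains U :: "nat \<Rightarrow> 'a::metric_space set" where "A \<subseteq> (\<Union>i. U i)" "\<And>i. bounded (U i)"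
    "\<And>i. diameter (U i) \<le> \<delta>" "(\<Sum>i. hausdorff_cost s (U i)) < \<epsilon>"
proof -
  have "hausdorff_premeasure \<delta> s A \<le> hausdorff_measure s A"
    unfolding hausdorff_measure_def using assms(2) by (intro SUP_upper) auto
  then have "hausdorff_premeasure \<delta> s A < \<epsilon>" using assms by simp
  then show ?thesis unfolding hausdorff_premeasure_def INF_less_iff using that by auto
qed

lemma hausdorff_null_iff_covers:
  "hausdorff_measure s A = 0 \<longleftrightarrow>
     (\<forall>\<delta>>0. \<forall>\<epsilon>>0. \<exists>U :: nat \<Rightarrow> 'a::metric_space set. A \<subseteq> (\<Union>i. U i) \<and>
        (\<forall>i. bounded (U i) \<and> diameter (U i) \<le> \<delta>) \<and> (\<Sum>i. hausdorff_cost s (U i)) \<le> \<epsilon>)"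
  (is "?L \<longleftrightarrow> ?R")
proof
  assume ?L
  show ?R
  proof (intro allI impI)
    fix \<delta> :: real and \<epsilon> :: ennreal
    assume "0 < \<delta>" "0 < \<epsilon>"
    from hausdorff_null_cover[OF \<open>?L\<close> this] show "\<exists>U :: nat \<Rightarrow> 'a set. A \<subseteq> (\<Union>i. U i) \<and>
        (\<forall>i. bounded (U i) \<and> diameter (U i) \<le> \<delta>) \<and> (\<Sum>i. hausdorff_cost s (U i)) \<le> \<epsilon>"
      by (metis less_imp_le)
  qed
next
  assume R: ?R
  have "hausdorff_premeasure \<delta> s A \<le> 0" if pos: "0 < \<delta>" for \<delta>
  proof (rule ccontr)
    assume "\<not> hausdorff_premeasure \<delta> s A \<le> 0"
    then obtain \<epsilon> where \<epsilon>: "0 < \<epsilon>" "\<epsilon> < hausdorff_premeasure \<delta> s A"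
      using dense[of 0 "hausdorff_premeasure \<delta> s A"] by (metis not_le)
    obtain U :: "nat \<Rightarrow> 'a set" where U: "A \<subseteq> (\<Union>i. U i)" "\<forall>i. bounded (U i) \<and> diameter (U i) \<le> \<delta>"
      "(\<Sum>i. hausdorff_cost s (U i)) \<le> \<epsilon>"
      using R[rule_format, OF pos \<epsilon>(1)] by (elim exE conjE)
    have "hausdorff_premeasure \<delta> s A \<le> (\<Sum>i. hausdorff_cost s (U i))"
      unfolding hausdorff_premeasure_def by (rule INF_lower) (use U in blast)
    then show False using U(3) \<epsilon>(2) by simp
  qed
  then show ?L
    unfolding hausdorff_measure_def by (intro antisym[OF SUP_least]) auto
qed

lemma hausdorff_null_subset:
  assumes "hausdorff_measure s B = 0" "A \<subseteq> B"
  shows "hausdorff_measure s A = 0"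
  unfolding hausdorff_null_iff_covers
proof (intro allI impI)
  fix \<delta> :: real and \<epsilon> :: ennreal
  assume "0 < \<delta>" "0 < \<epsilon>"
  then obtain U where U: "B \<subseteq> (\<Union>i. U i)" "\<And>i. bounded (U i)" "\<And>i. diameter (U i) \<le> \<delta>"
      "(\<Sum>i. hausdorff_cost s (U i)) < \<epsilon>"
    using hausdorff_null_cover[OF assms(1)] by metis
  show "\<exists>U. A \<subseteq> (\<Union>i. U i) \<and> (\<forall>i. bounded (U i) \<and> diameter (U i) \<le> \<delta>) \<and> (\<Sum>i. hausdorff_cost s (U i)) \<le> \<epsilon>"
    using U(2-) less_imp_le[OF U(4)] subset_trans[OF assms(2) U(1)] by (intro exI[of _ U]) simp
qed

lemma hausdorff_null_UN:
  fixes A :: "nat \<Rightarrow> 'a::metric_space set"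
  assumes "\<And>n. hausdorff_measure s (A n) = 0"
  shows "hausdorff_measure s (\<Union>n. A n) = 0"
  unfolding hausdorff_null_iff_covers
proof (intro allI impI)
  fix \<delta> :: real and \<epsilon> :: ennreal
  assume \<delta>: "0 < \<delta>" and \<epsilon>: "0 < \<epsilon>"
  obtain e where e: "0 < e" "ennreal e \<le> \<epsilon>"
  proof (cases \<epsilon>)
    case (real r) then show ?thesis using \<epsilon> that[of r] by (cases "r = 0") auto
  next
    case top then show ?thesis using that[of 1] by simp
  qed
  have "\<exists>U :: nat \<Rightarrow> 'a set. A n \<subseteq> (\<Union>i. U i) \<and>
        (\<forall>i. bounded (U i) \<and> diameter (U i) \<le> \<delta>) \<and>
        (\<Sum>i. hausdorff_cost s (U i)) \<le> ennreal (e * (1/2) ^ Suc n)" for n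
    using assms[of n] \<delta> e unfolding hausdorff_null_iff_covers by simp
  then obtain U :: "nat \<Rightarrow> nat \<Rightarrow> 'a set" where U: "\<And>n. A n \<subseteq> (\<Union>i. U n i)"
    "\<And>n i. bounded (U n i)" "\<And>n i. diameter (U n i) \<le> \<delta>"
    "\<And>n. (\<Sum>i. hausdorff_cost s (U n i)) \<le> ennreal (e * (1/2) ^ Suc n)"
    by metis
  define V where "V = (\<lambda>k. case prod_decode k of (n, i) \<Rightarrow> U n i)"
  have "(\<Sum>k. hausdorff_cost s (V k)) = (\<Sum>n. \<Sum>i. hausdorff_cost s (U n i))"
    using suminf_ennreal_2dimen[of "\<lambda>n. \<Sum>i. hausdorff_cost s (U n i)"
        "\<lambda>(n, i). hausdorff_cost s (U n i)"]
    by (simp add: V_def case_prod_unfold)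
  also have "\<dots> \<le> (\<Sum>n. ennreal (e * (1/2) ^ Suc n))"
    using U(4) by (intro suminf_le) auto
  also have "\<dots> = ennreal (\<Sum>n. e * (1/2) ^ Suc n)"
    using e sums_summable[OF power_half_series]
    by (intro suminf_ennreal2 summable_mult) auto
  also have "(\<Sum>n. e * (1/2) ^ Suc n) = e"
    using sums_unique[OF sums_mult[OF power_half_series, of e]] by simp
  finally have cost: "(\<Sum>k. hausdorff_cost s (V k)) \<le> \<epsilon>" using e(2) by simp
  have "(\<Union>n. A n) \<subseteq> (\<Union>k. V k)"
  proof
    fix x assume "x \<in> (\<Union>n. A n)"
    then obtain n i where "x \<in> U n i" using U(1) by blast
    then show "x \<in> (\<Union>k. V k)"
      by (intro UN_I[of "prod_encode (n, i)"]) (auto simp: V_def)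
  qed
  with cost U(2,3) show "\<exists>U :: nat \<Rightarrow> 'a set. (\<Union>n. A n) \<subseteq> (\<Union>i. U i) \<and>
      (\<forall>i. bounded (U i) \<and> diameter (U i) \<le> \<delta>) \<and> (\<Sum>i. hausdorff_cost s (U i)) \<le> \<epsilon>"
    by (intro exI[of _ V]) (auto simp: V_def split: prod.split)
qed

lemma diameter_cbox_square_le:
  fixes x y l :: real
  assumes "0 \<le> l"
  shows "diameter (cbox (x, y) (x + l, y + l)) \<le> 2 * l"
proof (rule diameter_le)
  show "cbox (x, y) (x + l, y + l) \<noteq> {} \<or> 0 \<le> 2 * l" using assms by simp
  fix p q assume pq: "p \<in> cbox (x, y) (x + l, y + l)" "q \<in> cbox (x, y) (x + l, y + l)"
  have "norm (p - q) \<le> norm (fst (p - q)) + norm (snd (p - q))"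
    using norm_Pair_le[of "fst (p - q)" "snd (p - q)"] by (simp only: prod.collapse)
  also have "\<dots> \<le> l + l"
    using pq by (intro add_mono) (auto simp: cbox_Pair_eq mem_Times_iff)
  finally show "norm (p - q) \<le> 2 * l" by simp
qed

text \<open>
  Cutting the square into \<open>N\<^sup>2\<close> equal squares costs at most \<open>N\<^sup>2 (2/N)\<^sup>s\<close>, which tends to 0 because
  \<open>s > 2\<close>.
\<close>

lemma hausdorff_null_unit_square:
  fixes x y :: real
  assumes "2 < s"
  shows "hausdorff_measure s (cbox (x, y) (x + 1, y + 1)) = 0"
  unfolding hausdorff_null_iff_covers
proof (intro allI impI)
  fix \<delta> :: real and \<epsilon> :: ennreal
  assume \<delta>: "0 < \<delta>" and \<epsilon>: "0 < \<epsilon>"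
  have "(\<lambda>N. real N powr (2 - s)) \<longlonglongrightarrow> 0"
    using assms by (intro tendsto_neg_powr filterlim_real_sequentially) auto
  then have "(\<lambda>N. ennreal (2 powr s * real N powr (2 - s))) \<longlonglongrightarrow> ennreal (2 powr s * 0)"
    by (intro tendsto_ennrealI tendsto_mult tendsto_const)
  then have "\<forall>\<^sub>F N in sequentially. ennreal (2 powr s * real N powr (2 - s)) < \<epsilon>"
    using \<epsilon> by (intro order_tendstoD(2)) auto
  moreover have "(\<lambda>N. 2 / real N) \<longlonglongrightarrow> 0"
    by (rule lim_const_over_n)
  then have "\<forall>\<^sub>F N in sequentially. 2 / real N < \<delta>"
    using \<delta> by (intro order_tendstoD(2)) auto
  moreover have "\<forall>\<^sub>F N in sequentially. (0::nat) < N" by (rule eventually_gt_at_top)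
  ultimately have "\<forall>\<^sub>F N in sequentially. ennreal (2 powr s * real N powr (2 - s)) < \<epsilon> \<and> 2 / real N < \<delta> \<and> 0 < N"
    by eventually_elim auto
  then obtain N where N: "ennreal (2 powr s * real N powr (2 - s)) < \<epsilon>" "2 / real N < \<delta>" "0 < N"
    using eventually_happens trivial_limit_sequentially by blast
  define Q where "Q = (\<lambda>i. cbox (x + (i div N) / N, y + (i mod N) / N) (x + (i div N) / N + 1 / N, y + (i mod N) / N + 1 / N))"
  define U where "U = (\<lambda>i. if i < N * N then Q i else {})"
  have diam: "diameter (Q i) \<le> 2 / N" for i
    unfolding Q_def using diameter_cbox_square_le[of "1 / N"] by simp
  have cost: "hausdorff_cost s (U i) \<le> (if i < N * N then ennreal ((2 / N) powr s) else 0)" for i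
    using assms diam[of i] diameter_ge_0[of "Q i"]
    by (auto simp: U_def hausdorff_cost_def Q_def intro!: ennreal_leI powr_mono2 bounded_cbox)
  have "(\<Sum>i. hausdorff_cost s (U i)) = (\<Sum>i\<in>{..<N*N}. hausdorff_cost s (U i))"
    by (intro suminf_finite) (auto simp: U_def hausdorff_cost_def)
  also have "\<dots> \<le> (\<Sum>i\<in>{..<N*N}. ennreal ((2 / N) powr s))"
    by (intro sum_mono order_trans[OF cost]) auto
  also have "\<dots> = ennreal (real (N * N) * (2 / N) powr s)"
    by (subst sum_ennreal) auto
  also have "real (N * N) * (2 / N) powr s = 2 powr s * real N powr (2 - s)"
  proof -
    have "real N powr 2 = real (N * N)" using N(3) by (simp add: power2_eq_square)
    then show ?thesis by (simp add: powr_divide powr_diff)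
  qed
  finally have "(\<Sum>i. hausdorff_cost s (U i)) \<le> \<epsilon>" using N(1) by simp
  moreover have "cbox (x, y) (x + 1, y + 1) \<subseteq> (\<Union>i. U i)"
  proof
    have index: "\<exists>k<N. z + k / N \<le> u \<and> u \<le> z + k / N + 1 / N" if u: "z \<le> u" "u \<le> z + 1" for z u :: real
    proof (cases "u = z + 1")
      case True
      then show ?thesis using N(3) by (intro exI[of _ "N - 1"]) (auto simp: of_nat_diff diff_divide_distrib)
    next
      case False
      define k where "k = nat \<lfloor>N * (u - z)\<rfloor>"
      have k: "real k = \<lfloor>N * (u - z)\<rfloor>" using u by (simp add: k_def)
      have "N * (u - z) < N * (1::real)" using False u N(3) by (intro mult_strict_left_mono) auto
      then have "k < N" using k by linarith
      moreover have "k \<le> N * (u - z)" "N * (u - z) < k + 1" using k by linarith+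
      then have "k / N \<le> u - z" "u - z \<le> (k + 1) / N"
        using N(3) by (simp_all add: pos_divide_le_eq pos_le_divide_eq mult.commute)
      ultimately show ?thesis by (intro exI[of _ k]) (auto simp: add_divide_distrib)
    qed
    fix p assume "p \<in> cbox (x, y) (x + 1, y + 1)"
    then obtain u v where p: "p = (u, v)" "x \<le> u" "u \<le> x + 1" "y \<le> v" "v \<le> y + 1"
      by (cases p) (auto simp: cbox_Pair_eq)
    obtain k where k: "k < N" "x + k / N \<le> u" "u \<le> x + k / N + 1 / N" using index p by blast
    obtain l where l: "l < N" "y + l / N \<le> v" "v \<le> y + l / N + 1 / N" using index p by blast
    have "k * N + l < N * N"
    proof -
      have "k * N + l < k * N + N" using l by simp
      also have "\<dots> = (k + 1) * N" by simp
      also have "\<dots> \<le> N * N" using k by (intro mult_right_mono) auto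
      finally show ?thesis .
    qed
    then show "p \<in> (\<Union>i. U i)" using k l p(1)
      by (intro UN_I[of "k * N + l"]) (auto simp: U_def Q_def cbox_Pair_eq)
  qed
  moreover have "bounded (U i) \<and> diameter (U i) \<le> \<delta>" for i
    using diam[of i] N(2) \<delta> by (auto simp: U_def Q_def)
  ultimately show "\<exists>U. cbox (x, y) (x + 1, y + 1) \<subseteq> (\<Union>i. U i) \<and>
      (\<forall>i. bounded (U i) \<and> diameter (U i) \<le> \<delta>) \<and> (\<Sum>i. hausdorff_cost s (U i)) \<le> \<epsilon>"
    by blast
qed

lemma hausdorff_null_plane:
  fixes E :: "(real \<times> real) set"
  assumes "2 < s"
  shows "hausdorff_measure s E = 0"
proof -
  define Q where "Q = (\<lambda>n. case from_nat n :: int \<times> int of (i, j) \<Rightarrow>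
                   cbox (real_of_int i, real_of_int j) (i + 1, j + 1))"
  have "hausdorff_measure s (\<Union>n. Q n) = 0"
    using hausdorff_null_unit_square[OF assms]
    by (intro hausdorff_null_UN) (auto simp: Q_def split: prod.split)
  moreover have "p \<in> (\<Union>n. Q n)" for p
    by (cases p, intro UN_I[of "to_nat (\<lfloor>fst p\<rfloor>, \<lfloor>snd p\<rfloor>)"])
       (auto simp: Q_def cbox_Pair_eq less_imp_le[OF floor_correct[THEN conjunct2]])
  then have "E \<subseteq> (\<Union>n. Q n)" by blast
  ultimately show ?thesis by (rule hausdorff_null_subset)
qed

lemma ex_dyadic_scale:
  fixes d :: real
  assumes "0 < d" "d \<le> 1 / 2 ^ k0"
  shows "\<exists>k\<ge>k0. 1 / 2 ^ Suc k < d \<and> d \<le> 1 / 2 ^ k"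
proof -
  define P where "P = (\<lambda>k. 1 / 2 ^ Suc k < d)"
  obtain n where "(1 / 2) ^ n < d" using real_arch_pow_inv[of d "1/2"] assms by auto
  then have "P n" using assms by (auto simp: P_def power_one_over field_simps)
  define k where "k = (LEAST k. P k)"
  have Pk: "P k" unfolding k_def by (rule LeastI[of P n]) fact
  have "d \<le> 1 / 2 ^ k"
  proof (cases k)
    case 0
    have "1 / 2 ^ k0 \<le> (1::real)" by (simp add: divide_le_eq)
    with assms(2) have "d \<le> 1" by (rule order_trans)
    then show ?thesis by (simp add: 0)
  next
    case (Suc j)
    then have "\<not> P j" using not_less_Least[of j P] by (simp add: k_def)
    then show ?thesis by (simp add: P_def Suc)
  qed
  moreover have "k0 \<le> k"
  proof (rule ccontr)
    assume "\<not> k0 \<le> k"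
    then have "(2::real) ^ Suc k \<le> 2 ^ k0" by (intro power_increasing) auto
    then have "1 / 2 ^ k0 \<le> (1::real) / 2 ^ Suc k" by (intro divide_left_mono) auto
    then show False using Pk assms(2) by (simp add: P_def)
  qed
  ultimately show ?thesis using Pk by (auto simp: P_def)
qed

text \<open>
  A covering set of diameter between \<open>2 powr (- k - 1)\<close> and \<open>2 powr (- k)\<close> lies within the nine
  dyadic squares of side \<open>2 powr (- k)\<close> around any of its points, and a cover of total cost at most 1
  contains at most \<open>2 powr (s (k + 1))\<close> such sets.
\<close>

lemma hausdorff_null_imp_dyadically_thin:
  fixes E :: "(real \<times> real) set"
  assumes s: "0 \<le> s" and null: "hausdorff_measure s E = 0"
  shows "dyadically_thin s E"
proof (cases "s = 0")
  case True
  obtain U :: "nat \<Rightarrow> (real \<times> real) set" where U: "E \<subseteq> (\<Union>i. U i)" "(\<Sum>i. hausdorff_cost s (U i)) < 1"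
    using hausdorff_null_cover[OF null zero_less_one zero_less_one] by metis
  \<comment> \<open>In dimension 0 every nonempty set costs 1, so a cheap cover consists of empty sets.\<close>
  have "U i = {}" for i
  proof (rule ccontr)
    assume "U i \<noteq> {}"
    then have "1 = (\<Sum>j\<in>{i}. hausdorff_cost s (U j))" using True by (simp add: hausdorff_cost_def)
    also have "\<dots> \<le> (\<Sum>j. hausdorff_cost s (U j))" by (intro sum_le_suminf) auto
    finally show False using U(2) by simp
  qed
  then have "E = {}" using U(1) by simp
  then show ?thesis unfolding dyadically_thin_def
    by (intro exI[of _ 0] allI exI[of _ "\<lambda>_. {}"]) auto
next
  case False
  then have s: "0 < s" using s by simp
  define C where "C = 9 * 2 powr s"
  have "\<exists>G :: nat \<Rightarrow> (int \<times> int) set. (\<forall>k. finite (G k) \<and> real (card (G k)) \<le> C * 2 powr (s * k)) \<and>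
        (\<forall>(p, q)\<in>E. \<exists>k\<ge>k0. (\<lfloor>2 ^ k * p\<rfloor>, \<lfloor>2 ^ k * q\<rfloor>) \<in> G k)" for k0 :: nat
  proof -
    have pos: "(0::real) < 1 / 2 ^ k0" by simp
    have half: "0 < ennreal (1 / 2)" unfolding ennreal_less_zero_iff by simp
    from hausdorff_null_cover[OF null pos half]
    obtain U :: "nat \<Rightarrow> (real \<times> real) set" where U: "E \<subseteq> (\<Union>i. U i)" "\<And>i. bounded (U i)"
      "\<And>i. diameter (U i) \<le> 1 / 2 ^ k0" "(\<Sum>i. hausdorff_cost s (U i)) < ennreal (1 / 2)"
      by metis
    \<comment> \<open>A covering set may be a single point and then has no dyadic scale. Each diameter is therefore
      enlarged to a positive number, at a total extra cost of \<open>\<Sum>i. \<eta> i = 1/2\<close>.\<close>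
    define \<eta> :: "nat \<Rightarrow> real" where "\<eta> = (\<lambda>i. (1 / 2) * (1 / 2) ^ Suc i)"
    have \<eta>: "0 < \<eta> i" "\<eta> i \<le> 1" for i
      using power_le_one[of "1 / 2 :: real" "Suc (Suc i)"] by (auto simp: \<eta>_def)
    have "\<eta> sums ((1 / 2) * 1)"
      unfolding \<eta>_def by (intro sums_mult power_half_series)
    then have \<eta>_sums: "\<eta> sums (1 / 2)" by simp
    have sum_\<eta>: "(\<Sum>i. ennreal (\<eta> i)) = ennreal (1 / 2)"
      unfolding sums_unique[OF \<eta>_sums]
      by (rule suminf_ennreal2[OF less_imp_le[OF \<eta>(1)] sums_summable[OF \<eta>_sums]])
    define \<tau> where "\<tau> = (\<lambda>i. 1 / 2 ^ k0 * \<eta> i powr (1 / s))"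
    define d where "d = (\<lambda>i. max (diameter (U i)) (\<tau> i))"
    have \<tau>_le: "\<tau> i powr s \<le> \<eta> i" for i
    proof -
      have "\<tau> i powr s = (1 / 2 ^ k0) powr s * (\<eta> i powr (1 / s)) powr s"
        unfolding \<tau>_def by (rule powr_mult)
      also have "(\<eta> i powr (1 / s)) powr s = \<eta> i"
        unfolding powr_powr using s \<eta>(1)[of i] by simp
      also have "(1 / 2 ^ k0) powr s \<le> (1::real) powr s"
        using s by (intro powr_mono2) auto
      finally show ?thesis using \<eta>(1)[of i] by (simp add: mult_right_mono)
    qed
    have "\<eta> i powr (1 / s) \<le> 1 powr (1 / s)" for i
      using s \<eta>[of i] by (intro powr_mono2) auto
    then have "\<tau> i \<le> 1 / 2 ^ k0" for i
      using mult_left_mono[of "\<eta> i powr (1 / s)" 1 "1 / 2 ^ k0"] by (simp add: \<tau>_def)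
    then have d_le: "d i \<le> 1 / 2 ^ k0" for i using U(3) by (simp add: d_def)
    have d_pos: "0 < d i" for i using \<eta>(1)[of i] by (simp add: d_def \<tau>_def less_max_iff_disj)
    have "\<forall>i. \<exists>k\<ge>k0. 1 / 2 ^ Suc k < d i \<and> d i \<le> 1 / 2 ^ k"
      using ex_dyadic_scale[OF d_pos d_le] by blast
    then obtain \<kappa> where \<kappa>: "\<And>i. k0 \<le> \<kappa> i" "\<And>i. 1 / 2 ^ Suc (\<kappa> i) < d i" "\<And>i. d i \<le> 1 / 2 ^ \<kappa> i"
      by metis
    define I where "I = (\<lambda>k. {i. \<kappa> i = k \<and> U i \<noteq> {}})"
    have I: "finite (I k) \<and> card (I k) \<le> nat \<lfloor>2 powr (s * Suc k)\<rfloor>" for k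
    proof (rule finite_if_finite_subsets_card_bdd)
      fix H assume H: "H \<subseteq> I k" "finite H"
      have "ennreal (card H * (1 / 2 ^ Suc k) powr s) = (\<Sum>i\<in>H. ennreal ((1 / 2 ^ Suc k) powr s))"
        by (subst sum_ennreal) auto
      also have "\<dots> \<le> (\<Sum>i\<in>H. hausdorff_cost s (U i) + ennreal (\<eta> i))"
      proof (rule sum_mono)
        fix i assume "i \<in> H"
        then have i: "\<kappa> i = k" "U i \<noteq> {}" using H by (auto simp: I_def)
        have "(1 / 2 ^ Suc k) powr s \<le> d i powr s"
          using \<kappa>(2)[of i] i s by (intro powr_mono2) auto
        also have "\<dots> \<le> diameter (U i) powr s + \<eta> i"
          using \<tau>_le[of i] less_imp_le[OF \<eta>(1)[of i]] by (auto simp: d_def max_def intro: add_increasing)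
        finally show "ennreal ((1 / 2 ^ Suc k) powr s) \<le> hausdorff_cost s (U i) + ennreal (\<eta> i)"
          using i s less_imp_le[OF \<eta>(1)[of i]] by (simp add: hausdorff_cost_def ennreal_leI flip: ennreal_plus)
      qed
      also have "\<dots> \<le> (\<Sum>i. hausdorff_cost s (U i)) + (\<Sum>i. ennreal (\<eta> i))"
        unfolding sum.distrib using H by (intro add_mono sum_le_suminf) auto
      also have "(\<Sum>i. ennreal (\<eta> i)) = ennreal (1 / 2)" by (rule sum_\<eta>)
      also have "(\<Sum>i. hausdorff_cost s (U i)) + ennreal (1 / 2) \<le> ennreal (1 / 2) + ennreal (1 / 2)"
        by (intro add_mono less_imp_le[OF U(4)] order_refl)
      also have "\<dots> = ennreal (1 / 2 + 1 / 2)" by (rule ennreal_plus[symmetric]) simp_all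
      also have "1 / 2 + 1 / 2 = (1::real)" by simp
      finally have "card H * (1 / 2 ^ Suc k) powr s \<le> 1" by (subst (asm) ennreal_le_iff) simp_all
      moreover have "(1 / 2 ^ Suc k) powr s = 1 / 2 powr (s * Suc k)"
        by (simp add: powr_realpow[symmetric] powr_divide powr_powr mult.commute del: of_nat_Suc power_Suc)
      ultimately have "card H \<le> 2 powr (s * Suc k)" by (simp add: pos_divide_le_eq del: of_nat_Suc)
      then show "card H \<le> nat \<lfloor>2 powr (s * Suc k)\<rfloor>" by (rule le_nat_floor)
    qed
    define z where "z = (\<lambda>i. SOME z. z \<in> U i)"
    have z: "z i \<in> U i" if "U i \<noteq> {}" for i using that by (simp add: z_def some_in_eq)
    define N where "N = (\<lambda>k i. {\<lfloor>2 ^ k * fst (z i)\<rfloor> - 1..\<lfloor>2 ^ k * fst (z i)\<rfloor> + 1}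
                             \<times> {\<lfloor>2 ^ k * snd (z i)\<rfloor> - 1..\<lfloor>2 ^ k * snd (z i)\<rfloor> + 1})"
    define G where "G = (\<lambda>k. \<Union>i\<in>I k. N k i)"
    have "finite (G k) \<and> real (card (G k)) \<le> C * 2 powr (s * k)" for k
    proof
      show "finite (G k)" using I by (auto simp: G_def N_def)
      have "card (G k) \<le> (\<Sum>i\<in>I k. card (N k i))"
        unfolding G_def using I by (intro card_UN_le) auto
      also have "\<dots> = 9 * card (I k)" by (simp add: N_def)
      finally have "real (card (G k)) \<le> 9 * real (card (I k))" by linarith
      also have "real (card (I k)) \<le> real (nat \<lfloor>2 powr (s * Suc k)\<rfloor>)" using I[of k] by (intro of_nat_mono) simp
      also have "\<dots> \<le> 2 powr (s * Suc k)" by (rule of_nat_floor) simp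
      also have "9 * 2 powr (s * Suc k) = C * 2 powr (s * k)"
        by (simp add: C_def powr_add[symmetric] distrib_left add.commute)
      finally show "real (card (G k)) \<le> C * 2 powr (s * k)" by simp
    qed
    moreover have "\<forall>(p, q)\<in>E. \<exists>k\<ge>k0. (\<lfloor>2 ^ k * p\<rfloor>, \<lfloor>2 ^ k * q\<rfloor>) \<in> G k"
    proof safe
      fix p q assume "(p, q) \<in> E"
      then obtain i where i: "(p, q) \<in> U i" using U(1) by blast
      have near: "\<lfloor>2 ^ \<kappa> i * u\<rfloor> \<in> {\<lfloor>2 ^ \<kappa> i * v\<rfloor> - 1..\<lfloor>2 ^ \<kappa> i * v\<rfloor> + 1}"
        if "dist u v \<le> dist (p, q) (z i)" for u v :: real
      proof -
        have "dist (p, q) (z i) \<le> diameter (U i)"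
          using i z by (intro diameter_bounded_bound U) auto
        also have "\<dots> \<le> 1 / 2 ^ \<kappa> i" using \<kappa>(3)[of i] by (simp add: d_def)
        finally have "\<bar>u - v\<bar> \<le> 1 / 2 ^ \<kappa> i" using that by (simp add: dist_real_def)
        then have "2 ^ \<kappa> i * \<bar>u - v\<bar> \<le> 1" by (simp add: field_simps)
        then have "\<bar>2 ^ \<kappa> i * u - 2 ^ \<kappa> i * v\<bar> \<le> 1"
          by (simp add: abs_mult flip: right_diff_distrib)
        then show ?thesis by simp linarith
      qed
      have "(\<lfloor>2 ^ \<kappa> i * p\<rfloor>, \<lfloor>2 ^ \<kappa> i * q\<rfloor>) \<in> N (\<kappa> i) i"
        using near[of p "fst (z i)"] near[of q "snd (z i)"]
          dist_fst_le[of "(p, q)" "z i"] dist_snd_le[of "(p, q)" "z i"] by (simp add: N_def)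
      moreover have "i \<in> I (\<kappa> i)" using i by (auto simp: I_def)
      ultimately show "\<exists>k\<ge>k0. (\<lfloor>2 ^ k * p\<rfloor>, \<lfloor>2 ^ k * q\<rfloor>) \<in> G k"
        using \<kappa>(1)[of i] by (auto simp: G_def)
    qed
    ultimately show ?thesis by blast
  qed
  then show ?thesis unfolding dyadically_thin_def by blast
qed

section \<open>Lines through the points of a curve\<close>

lemma line_through_point_cases:
  fixes L :: "(real \<times> real) set"
  assumes L: "is_line L" and p: "p \<in> L"
  obtains (vertical) "\<And>y. (fst p, y) \<in> L"
  | (slope) m where "\<And>t. (t, snd p + m * (t - fst p)) \<in> L"
proof -
  have "L \<noteq> {p}" using L by (auto simp: is_line_def)
  then obtain q where q: "q \<in> L" "q \<noteq> p" using p by auto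
  have on: "(1 - u) *\<^sub>R p + u *\<^sub>R q \<in> L" for u
    using L p q by (intro mem_affine) (auto simp: is_line_def)
  show ?thesis
  proof (cases "fst q = fst p")
    case True
    then have ne: "snd q \<noteq> snd p" using q(2) by (simp add: prod_eq_iff)
    show ?thesis
    proof (rule vertical)
      fix y
      define u where "u = (y - snd p) / (snd q - snd p)"
      have "u * (snd q - snd p) = y - snd p" using ne by (simp add: u_def)
      then have "(1 - u) *\<^sub>R p + u *\<^sub>R q = (fst p, y)"
        using True by (simp add: prod_eq_iff algebra_simps)
      then show "(fst p, y) \<in> L" using on[of u] by simp
    qed
  next
    case False
    show ?thesis
    proof (rule slope)
      fix t
      define u where "u = (t - fst p) / (fst q - fst p)"
      have u: "u * (fst q - fst p) = t - fst p" using False by (simp add: u_def)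
      have "(snd q - snd p) / (fst q - fst p) * (t - fst p) = u * (snd q - snd p)"
        by (simp add: u_def)
      then have "(1 - u) *\<^sub>R p + u *\<^sub>R q = (t, snd p + (snd q - snd p) / (fst q - fst p) * (t - fst p))"
        using u by (simp add: prod_eq_iff algebra_simps)
      then show "(t, snd p + (snd q - snd p) / (fst q - fst p) * (t - fst p)) \<in> L"
        using on[of u] by simp
    qed
  qed
qed

text \<open>
  Differentiability gives separation only near each point, with a constant depending on the point.
  Countably many pieces make the constant, the bound on the slope and the radius uniform, and
  each piece is cut into half-open intervals of that length.
\<close>

lemma thin_line_union_imp_negligible_local:
  fixes a b :: "real \<Rightarrow> real"
  assumes A: "A \<subseteq> {0..<1}" and s: "s < 2"
    and sep: "\<And>x. x \<in> A \<Longrightarrow> \<exists>\<epsilon>>0. \<forall>y\<in>A. \<bar>y - x\<bar> < \<epsilon> \<longrightarrow> \<epsilon> * \<bar>y - x\<bar> \<le> \<bar>a x - a y\<bar> + \<bar>b x - b y\<bar>"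
    and thin: "dyadically_thin s E"
    and lines: "\<And>x t. x \<in> A \<Longrightarrow> (t, a x + b x * t) \<in> E"
  shows "negligible A"
proof -
  define B where "B = (\<lambda>(n::nat, q::nat). {x \<in> A. \<bar>b x\<bar> \<le> n \<and> \<lfloor>real (Suc n) * x\<rfloor> = int q \<and>
      (\<forall>y\<in>A. \<bar>y - x\<bar> < 1 / Suc n \<longrightarrow> 1 / Suc n * \<bar>y - x\<bar> \<le> \<bar>a x - a y\<bar> + \<bar>b x - b y\<bar>)})"
  have "negligible (B (n, q))" for n q
  proof (rule thin_line_union_imp_negligible[OF _ s])
    show "B (n, q) \<subseteq> {0..<1}" using A by (auto simp: B_def)
    show "0 < 1 / real (Suc n)" by simp
    show "dyadically_thin s E" by fact
    fix x assume x: "x \<in> B (n, q)"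
    then show "\<bar>b x\<bar> \<le> n" "(t, a x + b x * t) \<in> E" for t using lines by (auto simp: B_def)
    fix y assume y: "y \<in> B (n, q)"
    have "\<lfloor>real (Suc n) * x\<rfloor> = \<lfloor>real (Suc n) * y\<rfloor>" using x y by (simp add: B_def)
    then have "\<bar>real (Suc n) * y - real (Suc n) * x\<bar> < 1" by linarith
    then have "real (Suc n) * \<bar>y - x\<bar> < 1"
      by (simp only: right_diff_distrib[symmetric] abs_mult abs_of_nat)
    then have "\<bar>y - x\<bar> < 1 / Suc n" by (simp add: pos_less_divide_eq mult.commute)
    then show "1 / Suc n * \<bar>x - y\<bar> \<le> \<bar>a x - a y\<bar> + \<bar>b x - b y\<bar>"
      using x y by (simp add: B_def abs_minus_commute)
  qed
  then have "negligible (\<Union>(range B))"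
    by (intro negligible_countable_Union) auto
  moreover have "A \<subseteq> \<Union>(range B)"
  proof
    fix x assume x: "x \<in> A"
    obtain \<epsilon> where \<epsilon>: "0 < \<epsilon>" "\<And>y. y \<in> A \<Longrightarrow> \<bar>y - x\<bar> < \<epsilon> \<Longrightarrow> \<epsilon> * \<bar>y - x\<bar> \<le> \<bar>a x - a y\<bar> + \<bar>b x - b y\<bar>"
      using sep[OF x] by blast
    \<comment> \<open>The natural number \<open>n\<close> bounds the slope, and \<open>1 / Suc n\<close> serves as both constant and radius.\<close>
    obtain n :: nat where n: "max \<bar>b x\<bar> (1 / \<epsilon>) \<le> n" using real_arch_simple by blast
    have "1 / \<epsilon> \<le> Suc n" using n by simp
    then have le: "1 / Suc n \<le> \<epsilon>" using \<epsilon>(1) by (simp add: field_simps)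
    have "1 / Suc n * \<bar>y - x\<bar> \<le> \<bar>a x - a y\<bar> + \<bar>b x - b y\<bar>" if "y \<in> A" "\<bar>y - x\<bar> < 1 / Suc n" for y
      using mult_right_mono[OF le, of "\<bar>y - x\<bar>"] \<epsilon>(2)[OF that(1)] that(2) le by linarith
    moreover have "\<lfloor>real (Suc n) * x\<rfloor> = int (nat \<lfloor>real (Suc n) * x\<rfloor>)" using x A by auto
    ultimately have "x \<in> B (n, nat \<lfloor>real (Suc n) * x\<rfloor>)" using x n by (simp add: B_def)
    then show "x \<in> \<Union>(range B)" by blast
  qed
  ultimately show ?thesis by (rule negligible_subset)
qed

text \<open>
  Vertical lines become horizontal ones, that is, graphs, after exchanging the coordinates.
\<close>

lemma dyadically_thin_swap:
  assumes "dyadically_thin s E"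
  shows "dyadically_thin s (prod.swap ` E)"
proof -
  obtain C where C: "\<And>k0. \<exists>G :: nat \<Rightarrow> (int \<times> int) set. (\<forall>k. finite (G k) \<and> real (card (G k)) \<le> C * 2 powr (s * k)) \<and>
        (\<forall>(p, q)\<in>E. \<exists>k\<ge>k0. (\<lfloor>2 ^ k * p\<rfloor>, \<lfloor>2 ^ k * q\<rfloor>) \<in> G k)"
    using assms unfolding dyadically_thin_def by blast
  show ?thesis unfolding dyadically_thin_def
  proof (intro exI[of _ C] allI)
    fix k0
    obtain G :: "nat \<Rightarrow> (int \<times> int) set" where G: "\<forall>k. finite (G k) \<and> real (card (G k)) \<le> C * 2 powr (s * k)"
      "\<forall>(p, q)\<in>E. \<exists>k\<ge>k0. (\<lfloor>2 ^ k * p\<rfloor>, \<lfloor>2 ^ k * q\<rfloor>) \<in> G k"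
      using C[of k0] by (elim exE conjE)
    show "\<exists>G :: nat \<Rightarrow> (int \<times> int) set. (\<forall>k. finite (G k) \<and> real (card (G k)) \<le> C * 2 powr (s * k)) \<and>
        (\<forall>(p, q)\<in>prod.swap ` E. \<exists>k\<ge>k0. (\<lfloor>2 ^ k * p\<rfloor>, \<lfloor>2 ^ k * q\<rfloor>) \<in> G k)"
      using G by (intro exI[of _ "\<lambda>k. prod.swap ` G k"]) (auto simp: card_image split: prod.splits)
  qed
qed

text \<open>
  The indices with \<open>F'' x \<noteq> 0\<close> split into those with a vertical, a transversal or a tangent line.
  In the transversal case the value at \<open>y\<close> of the line with index \<open>x\<close> differs from \<open>F y\<close>
  by \<open>(m x - F' x) (y - x)\<close> up to a smaller error, while the line with index \<open>y\<close> has the value \<open>F y\<close>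
  there. In the tangent case the slopes alone separate the lines.
\<close>

lemma curvature_negligible_if_thin_line_cover:
  fixes F F' F'' :: "real \<Rightarrow> real"
  assumes F: "\<And>x. x \<in> {0..1} \<Longrightarrow> (F has_real_derivative F' x) (at x within {0..1})"
    and F': "\<And>x. x \<in> {0..1} \<Longrightarrow> (F' has_real_derivative F'' x) (at x within {0..1})"
    and X: "\<forall>L\<in>X. is_line L" and cov: "graph_on F {0..1} \<subseteq> \<Union>X"
    and thin: "dyadically_thin s (\<Union>X)" and s: "s < 2"
  shows "negligible {x \<in> {0..<1}. F'' x \<noteq> 0}"
proof -
  define V where "V = {x \<in> {0..<1}. \<forall>y. (x, y) \<in> \<Union>X}"
  have "\<exists>m. \<forall>t. (t, F x + m * (t - x)) \<in> \<Union>X" if x: "x \<in> {0..<1} - V" for x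
  proof -
    have "(x, F x) \<in> graph_on F {0..1}" using x by (auto simp: graph_on_def)
    with cov obtain L where L: "L \<in> X" "(x, F x) \<in> L" by blast
    with X have "is_line L" by blast
    from this L(2) show ?thesis
    proof (cases rule: line_through_point_cases)
      case vertical
      then have "(x, y) \<in> \<Union>X" for y using L(1) by auto
      then have "x \<in> V" using x by (simp add: V_def)
      then show ?thesis using x by simp
    next
      case (slope m)
      then have "(t, F x + m * (t - x)) \<in> \<Union>X" for t using L(1) by auto
      then show ?thesis by blast
    qed
  qed
  then obtain m where m: "\<And>x t. x \<in> {0..<1} - V \<Longrightarrow> (t, F x + m x * (t - x)) \<in> \<Union>X"
    by metis
  have lines: "(t, (F x - m x * x) + m x * t) \<in> \<Union>X" if "x \<in> {0..<1} - V" for x t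
    using m[OF that, of t] by (simp add: algebra_simps)
  define R where "R = {x \<in> {0..<1} - V. m x \<noteq> F' x}"
  define T where "T = {x \<in> {0..<1} - V. m x = F' x \<and> F'' x \<noteq> 0}"
  have "negligible V"
  proof (rule thin_line_union_imp_negligible_local[where a = "\<lambda>x. x" and b = "\<lambda>_. 0", OF _ s _ dyadically_thin_swap[OF thin]])
    show "V \<subseteq> {0..<1}" by (auto simp: V_def)
    show "(t, x + 0 * t) \<in> prod.swap ` \<Union>X" if "x \<in> V" for x t
    proof (rule image_eqI)
      show "(x, t) \<in> \<Union>X" using that unfolding V_def by blast
    qed simp
    show "\<exists>\<epsilon>>0. \<forall>y\<in>V. \<bar>y - x\<bar> < \<epsilon> \<longrightarrow> \<epsilon> * \<bar>y - x\<bar> \<le> \<bar>x - y\<bar> + \<bar>0 - 0 :: real\<bar>" for x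
      by (intro exI[of _ 1]) auto
  qed
  moreover have "negligible R"
  proof (rule thin_line_union_imp_negligible_local[where a = "\<lambda>x. F x - m x * x" and b = m, OF _ s _ thin])
    show "R \<subseteq> {0..<1}" by (auto simp: R_def)
    show "(t, (F x - m x * x) + m x * t) \<in> \<Union>X" if "x \<in> R" for x t
      using that by (intro lines) (auto simp: R_def)
    fix x assume x: "x \<in> R"
    define e where "e = \<bar>m x - F' x\<bar> / 2"
    have e: "0 < e" using x by (simp add: R_def e_def)
    obtain d where d: "0 < d" "\<And>y. y \<in> {0..1} \<Longrightarrow> \<bar>y - x\<bar> < d \<Longrightarrow> \<bar>F y - F x - F' x * (y - x)\<bar> \<le> e * \<bar>y - x\<bar>"
      using F[of x] x e unfolding has_field_derivative_def has_derivative_within_alt R_def by force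
    have "e * \<bar>y - x\<bar> \<le> \<bar>(F x - m x * x) - (F y - m y * y)\<bar> + \<bar>m x - m y\<bar>"
      if y: "y \<in> R" "\<bar>y - x\<bar> < d" for y
    proof -
      have y01: "y \<in> {0..1}" using y by (auto simp: R_def)
      have "2 * e * \<bar>y - x\<bar> = \<bar>(m x - F' x) * (y - x)\<bar>" by (simp add: e_def abs_mult)
      also have "(m x - F' x) * (y - x) = ((F x - m x * x) - (F y - m y * y)) + (m x - m y) * y + (F y - F x - F' x * (y - x))"
        by (simp add: algebra_simps)
      also have "\<bar>\<dots>\<bar> \<le> \<bar>(F x - m x * x) - (F y - m y * y)\<bar> + \<bar>(m x - m y) * y\<bar> + e * \<bar>y - x\<bar>"
        using d(2)[OF y01 y(2)] by linarith
      also have "\<bar>(m x - m y) * y\<bar> \<le> \<bar>m x - m y\<bar>"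
        using y01 mult_left_mono[of "\<bar>y\<bar>" 1 "\<bar>m x - m y\<bar>"] by (simp add: abs_mult)
      finally show ?thesis by linarith
    qed
    moreover have "min d e * \<bar>y - x\<bar> \<le> e * \<bar>y - x\<bar>" for y by (intro mult_right_mono) auto
    ultimately show "\<exists>\<epsilon>>0. \<forall>y\<in>R. \<bar>y - x\<bar> < \<epsilon> \<longrightarrow>
        \<epsilon> * \<bar>y - x\<bar> \<le> \<bar>(F x - m x * x) - (F y - m y * y)\<bar> + \<bar>m x - m y\<bar>"
      using d(1) e by (intro exI[of _ "min d e"]) (auto intro: order_trans)
  qed
  moreover have "negligible T"
  proof (rule thin_line_union_imp_negligible_local[where a = "\<lambda>x. F x - m x * x" and b = m, OF _ s _ thin])
    show "T \<subseteq> {0..<1}" by (auto simp: T_def)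
    show "(t, (F x - m x * x) + m x * t) \<in> \<Union>X" if "x \<in> T" for x t
      using that by (intro lines) (auto simp: T_def)
    fix x assume x: "x \<in> T"
    define e where "e = \<bar>F'' x\<bar> / 2"
    have e: "0 < e" using x by (simp add: T_def e_def)
    obtain d where d: "0 < d" "\<And>y. y \<in> {0..1} \<Longrightarrow> \<bar>y - x\<bar> < d \<Longrightarrow> \<bar>F' y - F' x - F'' x * (y - x)\<bar> \<le> e * \<bar>y - x\<bar>"
      using F'[of x] x e unfolding has_field_derivative_def has_derivative_within_alt T_def by force
    have "e * \<bar>y - x\<bar> \<le> \<bar>(F x - m x * x) - (F y - m y * y)\<bar> + \<bar>m x - m y\<bar>"
      if y: "y \<in> T" "\<bar>y - x\<bar> < d" for y
    proof -
      have "2 * e * \<bar>y - x\<bar> = \<bar>F'' x * (y - x)\<bar>" by (simp add: e_def abs_mult)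
      moreover have "\<bar>F' y - F' x - F'' x * (y - x)\<bar> \<le> e * \<bar>y - x\<bar>"
        using y by (intro d) (auto simp: T_def)
      moreover have "m x - m y = F' x - F' y" using x y by (simp add: T_def)
      ultimately show ?thesis by linarith
    qed
    moreover have "min d e * \<bar>y - x\<bar> \<le> e * \<bar>y - x\<bar>" for y by (intro mult_right_mono) auto
    ultimately show "\<exists>\<epsilon>>0. \<forall>y\<in>T. \<bar>y - x\<bar> < \<epsilon> \<longrightarrow>
        \<epsilon> * \<bar>y - x\<bar> \<le> \<bar>(F x - m x * x) - (F y - m y * y)\<bar> + \<bar>m x - m y\<bar>"
      using d(1) e by (intro exI[of _ "min d e"]) (auto intro: order_trans)
  qed
  ultimately have "negligible (V \<union> R \<union> T)" by (intro negligible_Un)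
  then show ?thesis by (rule negligible_subset) (auto simp: R_def T_def)
qed

text \<open>
  Every derivative on an interval is Henstock--Kurzweil integrable with the expected integral, and the
  integral ignores null sets. Differentiability of \<open>F'\<close> at every point is essential: the Cantor
  function has derivative 0 almost everywhere and is not constant.
\<close>

lemma affine_if_second_derivative_ae_zero:
  fixes F F' F'' :: "real \<Rightarrow> real"
  assumes F: "\<And>x. x \<in> {0..1} \<Longrightarrow> (F has_real_derivative F' x) (at x within {0..1})"
    and F': "\<And>x. x \<in> {0..1} \<Longrightarrow> (F' has_real_derivative F'' x) (at x within {0..1})"
    and null: "negligible {x \<in> {0..<1}. F'' x \<noteq> 0}"
  shows "\<forall>x\<in>{0..1}. F x = F' 0 * x + F 0"
proof
  have FTC: "(g' has_integral g x - g 0) {0..x}"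
    if "x \<in> {0..1}" "\<And>x. x \<in> {0..1} \<Longrightarrow> (g has_real_derivative g' x) (at x within {0..1})"
    for g g' :: "real \<Rightarrow> real" and x
  proof (rule fundamental_theorem_of_calculus)
    fix y assume "y \<in> {0..x}"
    then have "(g has_real_derivative g' y) (at y within {0..x})"
      using that by (intro DERIV_subset[OF that(2)]) auto
    then show "(g has_vector_derivative g' y) (at y within {0..x})"
      by (simp add: has_real_derivative_iff_has_vector_derivative)
  qed (use that in simp)
  have const: "F' x = F' 0" if x: "x \<in> {0..1}" for x
  proof -
    have "((\<lambda>_. 0) has_integral F' x - F' 0) {0..x}"
    proof (rule has_integral_spike[OF _ _ FTC[OF x F']])
      show "negligible (insert 1 {x \<in> {0..<1}. F'' x \<noteq> 0})" using null by simp
    qed (use x in auto)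
    then have "F' x - F' 0 = 0" by (rule has_integral_unique[OF _ has_integral_0])
    then show ?thesis by simp
  qed
  fix x :: real assume x: "x \<in> {0..1}"
  have "((\<lambda>_. F' 0) has_integral F x - F 0) {0..x}"
  proof (rule has_integral_eq[OF _ FTC[OF x F]])
    show "F' y = F' 0" if "y \<in> {0..x}" for y using that x by (intro const) auto
  qed
  moreover have "((\<lambda>_. F' 0) has_integral x * F' 0) {0..x}"
    using has_integral_const_real[of "F' 0" 0 x] x by simp
  ultimately have "F x - F 0 = x * F' 0" by (rule has_integral_unique)
  then show "F x = F' 0 * x + F 0" by (simp add: mult.commute)
qed

theorem corollary2p8:
  fixes F :: "real \<Rightarrow> real" and X :: "(real \<times> real) set set"
  assumes "twice_differentiable_on F {0..1}"
    and "\<not> (\<exists>a b. \<forall>x\<in>{0..1}. F x = a * x + b)"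
    and "\<forall>L\<in>X. is_line L"
    and "graph_on F {0..1} \<subseteq> \<Union>X"
  shows "hausdorff_dim (\<Union>X) = 2"
proof -
  obtain F' F'' where F: "\<And>x. x \<in> {0..1} \<Longrightarrow> (F has_real_derivative F' x) (at x within {0..1})"
    and F': "\<And>x. x \<in> {0..1} \<Longrightarrow> (F' has_real_derivative F'' x) (at x within {0..1})"
    using assms(1) unfolding twice_differentiable_on_def by blast
  have lower: "2 \<le> s" if "0 \<le> s" "hausdorff_measure s (\<Union>X) = 0" for s
  proof (rule ccontr)
    assume "\<not> 2 \<le> s"
    then have "negligible {x \<in> {0..<1}. F'' x \<noteq> 0}"
      using curvature_negligible_if_thin_line_cover[OF F F' assms(3,4)]
        hausdorff_null_imp_dyadically_thin[OF that] by force
    then show False using affine_if_second_derivative_ae_zero[OF F F'] assms(2) by blast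
  qed
  show ?thesis unfolding hausdorff_dim_def
  proof (rule antisym)
    show "Inf {ennreal s |s. 0 \<le> s \<and> hausdorff_measure s (\<Union>X) = 0} \<le> 2"
    proof (rule ennreal_le_epsilon)
      fix e :: real assume "0 < e"
      then have "Inf {ennreal s |s. 0 \<le> s \<and> hausdorff_measure s (\<Union>X) = 0} \<le> ennreal (2 + e)"
        using hausdorff_null_plane[of "2 + e" "\<Union>X"] by (intro Inf_lower CollectI exI[of _ "2 + e"]) auto
      then show "Inf {ennreal s |s. 0 \<le> s \<and> hausdorff_measure s (\<Union>X) = 0} \<le> 2 + ennreal e"
        using \<open>0 < e\<close> by (simp add: ennreal_plus)
    qed
    show "2 \<le> Inf {ennreal s |s. 0 \<le> s \<and> hausdorff_measure s (\<Union>X) = 0}"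
    proof (rule Inf_greatest)
      fix d assume "d \<in> {ennreal s |s. 0 \<le> s \<and> hausdorff_measure s (\<Union>X) = 0}"
      then obtain s where "d = ennreal s" "0 \<le> s" "2 \<le> s" using lower by blast
      then show "2 \<le> d" using ennreal_leI[of 2 s] by simp
    qed
  qed
qed

end
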